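(* A geodesic metric space $(X,d)$ is hyperbolic if and only if its hyperbolicity function $f_X$ is sub-linear, i.e. $\lim_{t\to\infty}\frac{f_X(t)}{t}=0$.
   Context: A geodesic metric space is hyperbolic if there is $\delta>0$ such that in every geodesic triangle each side is contained in the $\delta$-neighborhood of the union of the other two sides. Hyperbolicity function: for $t\ge 0$ let $S_t$ be the set of all geodesic triangles in $X$ of perimeter at most $t$. For a geodesic triangle $\triangle$, let $\delta_\triangle$ be the supremum, over all points $p$ lying on a side of $\triangle$, of the distance from $p$ to the union of the other two sides. The hyperbolicity function $f_X:[0,\infty)\to[0,\infty)$ is $f_X(t)=\sup_{\triangle\in S_t}\delta_\triangle$. *)

theory Defs
  imports "HOL-Analysis.Analysis"
begin

text \<open>
  A metric space \<open>(X, d)\<close> is a subset \<open>X\<close> of a type of class \<open>metric_space\<close>, with the restricted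
  distance; \<open>X = UNIV\<close> is allowed. All geodesics are required to stay inside \<open>X\<close>.
\<close>

definition geodesic_segment :: "'a::metric_space set \<Rightarrow> 'a \<Rightarrow> 'a \<Rightarrow> 'a set \<Rightarrow> bool" where
  "geodesic_segment X x y G \<longleftrightarrow>
     (\<exists>g :: real \<Rightarrow> 'a.
        g 0 = x \<and> g (dist x y) = y \<and>
        (\<forall>s\<in>{0..dist x y}. \<forall>t\<in>{0..dist x y}. dist (g s) (g t) = \<bar>s - t\<bar>) \<and>
        G = g ` {0..dist x y} \<and> G \<subseteq> X)"

definition geodesic_metric_space :: "'a::metric_space set \<Rightarrow> bool" where
  "geodesic_metric_space X \<longleftrightarrow> (\<forall>x\<in>X. \<forall>y\<in>X. \<exists>G. geodesic_segment X x y G)"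

definition geodesic_triangle ::
    "'a::metric_space set \<Rightarrow> 'a \<Rightarrow> 'a \<Rightarrow> 'a \<Rightarrow> 'a set \<Rightarrow> 'a set \<Rightarrow> 'a set \<Rightarrow> bool" where
  "geodesic_triangle X x y z A B C \<longleftrightarrow>
     geodesic_segment X x y A \<and> geodesic_segment X y z B \<and> geodesic_segment X z x C"

definition triangle_perimeter :: "'a::metric_space \<Rightarrow> 'a \<Rightarrow> 'a \<Rightarrow> real" where
  "triangle_perimeter x y z = dist x y + dist y z + dist z x"

definition metric_neighbourhood :: "real \<Rightarrow> 'a::metric_space set \<Rightarrow> 'a set" where
  "metric_neighbourhood \<delta> S = (\<Union>q\<in>S. ball q \<delta>)"

definition hyperbolic_space :: "'a::metric_space set \<Rightarrow> bool" where
  "hyperbolic_space X \<longleftrightarrow>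
     (\<exists>\<delta>>0. \<forall>x y z A B C. geodesic_triangle X x y z A B C \<longrightarrow>
        A \<subseteq> metric_neighbourhood \<delta> (B \<union> C) \<and>
        B \<subseteq> metric_neighbourhood \<delta> (C \<union> A) \<and>
        C \<subseteq> metric_neighbourhood \<delta> (A \<union> B))"

definition triangle_delta :: "'a::metric_space set \<Rightarrow> 'a set \<Rightarrow> 'a set \<Rightarrow> real" where
  "triangle_delta A B C =
     Sup ((\<lambda>p. infdist p (B \<union> C)) ` A \<union>
          (\<lambda>p. infdist p (C \<union> A)) ` B \<union>
          (\<lambda>p. infdist p (A \<union> B)) ` C)"

text \<open>
  The suprema are taken in the reals. The lemmas below show that the sets are bounded above; they
  are nonempty as well (the second one as soon as \<open>X\<close> is nonempty and \<open>t \<ge> 0\<close>, by degenerate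
  triangles). For \<open>X = {}\<close> or \<open>t < 0\<close> the value is the unspecified constant \<open>Sup {}\<close>.
\<close>

definition hyperbolicity_function :: "'a::metric_space set \<Rightarrow> real \<Rightarrow> real" where
  "hyperbolicity_function X t =
     Sup {triangle_delta A B C | A B C.
            \<exists>x y z. geodesic_triangle X x y z A B C \<and> triangle_perimeter x y z \<le> t}"

lemma geodesic_segment_endpoints:
  assumes "geodesic_segment X x y G"
  shows "x \<in> G" "y \<in> G"
proof -
  obtain g where g: "g 0 = x" "g (dist x y) = y" "G = g ` {0..dist x y}"
    using assms unfolding geodesic_segment_def by blast
  have "g 0 \<in> G" "g (dist x y) \<in> G"
    unfolding g(3) by (intro imageI; simp)+
  then show "x \<in> G" "y \<in> G"
    by (simp_all only: g(1,2))
qed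

lemma geodesic_segment_dist_le:
  assumes "geodesic_segment X x y G" "p \<in> G"
  shows "dist p x \<le> dist x y"
proof -
  obtain g where g: "g 0 = x" "G = g ` {0..dist x y}"
    and iso: "\<forall>s\<in>{0..dist x y}. \<forall>t\<in>{0..dist x y}. dist (g s) (g t) = \<bar>s - t\<bar>"
    using assms(1) unfolding geodesic_segment_def by blast
  obtain s where s: "s \<in> {0..dist x y}" "p = g s"
    using assms(2) unfolding g(2) by blast
  have "dist (g s) (g 0) = \<bar>s - 0\<bar>"
    using iso s(1) zero_le_dist[of x y] by (metis atLeastAtMost_iff order_refl)
  then have "dist p x = s"
    using s unfolding g(1) by simp
  then show ?thesis
    using s(1) by simp
qed

lemma infdist_side_le_perimeter:
  assumes "geodesic_triangle X x y z A B C"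
  shows "p \<in> A \<Longrightarrow> infdist p (B \<union> C) \<le> triangle_perimeter x y z"
    and "p \<in> B \<Longrightarrow> infdist p (C \<union> A) \<le> triangle_perimeter x y z"
    and "p \<in> C \<Longrightarrow> infdist p (A \<union> B) \<le> triangle_perimeter x y z"
proof -
  have seg: "geodesic_segment X x y A" "geodesic_segment X y z B" "geodesic_segment X z x C"
    using assms by (auto simp: geodesic_triangle_def)
  have nn: "dist x y \<ge> 0" "dist y z \<ge> 0" "dist z x \<ge> 0"
    by simp_all
  note ends = seg[THEN geodesic_segment_endpoints(1)] seg[THEN geodesic_segment_endpoints(2)]
  show "infdist p (B \<union> C) \<le> triangle_perimeter x y z" if "p \<in> A"
  proof -
    have "infdist p (B \<union> C) \<le> dist p x"
      using ends by (intro infdist_le) simp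
    then show ?thesis
      using geodesic_segment_dist_le[OF seg(1) that] nn
      unfolding triangle_perimeter_def by linarith
  qed
  show "infdist p (C \<union> A) \<le> triangle_perimeter x y z" if "p \<in> B"
  proof -
    have "infdist p (C \<union> A) \<le> dist p y"
      using ends by (intro infdist_le) simp
    then show ?thesis
      using geodesic_segment_dist_le[OF seg(2) that] nn
      unfolding triangle_perimeter_def by linarith
  qed
  show "infdist p (A \<union> B) \<le> triangle_perimeter x y z" if "p \<in> C"
  proof -
    have "infdist p (A \<union> B) \<le> dist p z"
      using ends by (intro infdist_le) simp
    then show ?thesis
      using geodesic_segment_dist_le[OF seg(3) that] nn
      unfolding triangle_perimeter_def by linarith
  qed
qed

lemma bdd_above_triangle_delta:
  assumes "geodesic_triangle X x y z A B C"
  shows "bdd_above ((\<lambda>p. infdist p (B \<union> C)) ` A \<union>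
                    (\<lambda>p. infdist p (C \<union> A)) ` B \<union>
                    (\<lambda>p. infdist p (A \<union> B)) ` C)"
  by (rule bdd_aboveI[of _ "triangle_perimeter x y z"])
     (use infdist_side_le_perimeter[OF assms] in auto)

lemma triangle_delta_le_perimeter:
  assumes "geodesic_triangle X x y z A B C"
  shows "triangle_delta A B C \<le> triangle_perimeter x y z"
proof -
  have "x \<in> A"
    using assms geodesic_segment_endpoints(1) unfolding geodesic_triangle_def by blast
  then show ?thesis
    unfolding triangle_delta_def
    by (intro cSup_least) (use infdist_side_le_perimeter[OF assms] in auto)
qed

lemma bdd_above_hyperbolicity_function:
  "bdd_above {triangle_delta A B C | A B C.
                \<exists>x y z. geodesic_triangle X x y z A B C \<and> triangle_perimeter x y z \<le> t}"
  by (rule bdd_aboveI[of _ t]) (blast intro: order_trans triangle_delta_le_perimeter)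

end

theory Submission
  imports Defs
begin

text \<open>
  If triangles are uniformly thin, the hyperbolicity function \<open>f\<close> is bounded, hence sublinear.

  For the converse, the heart is a self-improvement step (\<open>thin_up_to_halve\<close>): if all triangles of
  perimeter at most \<open>t\<close> are \<open>F\<close>-thin and all triangles of perimeter at most \<open>168 F\<close> are
  \<open>(F / 40)\<close>-thin, then triangles of perimeter at most \<open>t\<close> are even \<open>(F / 2)\<close>-thin. When \<open>f\<close> is
  sublinear, the second condition holds with \<open>F = f t\<close> as soon as \<open>f t\<close> exceeds a constant
  independent of \<open>t\<close>; the step then gives \<open>f t \<le> f t / 2\<close>, which is absurd. So \<open>f\<close> is bounded and
  the space is hyperbolic.

  To prove the step, suppose that \<open>p\<close> on the side \<open>A\<close> of a triangle is farther than \<open>F / 2\<close> from the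
  other two sides \<open>B\<close> and \<open>C\<close>. Move from \<open>p\<close> along \<open>A\<close> in both directions by \<open>4 F\<close> (or to the
  vertex, if it comes earlier). By \<open>F\<close>-thinness the two points reached are within \<open>2 F\<close> of points \<open>q\<close>
  and \<open>q'\<close> of \<open>B \<union> C\<close> (\<open>foot_far_from_point\<close>). The points \<open>q\<close> and \<open>q'\<close> can be joined by three
  segments that stay away from \<open>p\<close> and have their ends within \<open>28 F\<close> of \<open>p\<close>
  (\<open>detour_along_two_sides\<close>). This is clear if both lie on the same side. Otherwise, the triangle
  formed by \<open>q\<close>, \<open>q'\<close> and the common vertex of \<open>B\<close> and \<open>C\<close> has perimeter at most \<open>t\<close>, so it is
  \<open>F\<close>-thin, which permits crossing from one side to the other at distance about \<open>20 F\<close> from \<open>q\<close>.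
  Altogether, \<open>p\<close> lies on a side of a geodesic hexagon of size comparable to \<open>F\<close> and is farther than
  \<open>F / 2\<close> from the other five sides. Cutting the hexagon into triangles by diagonals
  (\<open>near_hexagon\<close>) contradicts the thinness at scale \<open>168 F\<close>.
\<close>

section \<open>Geodesic segments\<close>

lemma geodesic_segment_image:
  assumes iso: "\<And>s t. s \<in> {0..l} \<Longrightarrow> t \<in> {0..l} \<Longrightarrow> dist (g s) (g t) = \<bar>s - t\<bar>"
    and "g ` {0..l} \<subseteq> X" and ab: "0 \<le> a" "a \<le> b" "b \<le> l"
  shows "geodesic_segment X (g a) (g b) (g ` {a..b})"
proof -
  have d: "dist (g a) (g b) = b - a"
    using iso[of a b] ab by simp
  have im: "(\<lambda>s. g (a + s)) ` {0..b - a} = g ` {a..b}"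
    by (simp flip: image_image[of g "(+) a"])
  show ?thesis
    unfolding geodesic_segment_def d
  proof (intro exI[of _ "\<lambda>s. g (a + s)"] conjI ballI)
    fix s t assume "s \<in> {0..b - a}" "t \<in> {0..b - a}"
    then show "dist (g (a + s)) (g (a + t)) = \<bar>s - t\<bar>"
      using iso[of "a + s" "a + t"] ab by simp
  next
    show "g ` {a..b} \<subseteq> X"
      using assms(2) ab by (auto simp: image_subset_iff)
  qed (use im in auto)
qed

lemma geodesic_segmentE:
  assumes "geodesic_segment X x y G"
  obtains g where "g 0 = x" "g (dist x y) = y" "G = g ` {0..dist x y}" "G \<subseteq> X"
    "\<And>s t. s \<in> {0..dist x y} \<Longrightarrow> t \<in> {0..dist x y} \<Longrightarrow> dist (g s) (g t) = \<bar>s - t\<bar>"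
  using assms unfolding geodesic_segment_def by blast

lemma geodesic_segment_subset: "geodesic_segment X x y G \<Longrightarrow> G \<subseteq> X"
  unfolding geodesic_segment_def by blast

lemma geodesic_segment_commute:
  assumes "geodesic_segment X x y G"
  shows "geodesic_segment X y x G"
proof -
  obtain g where g: "g 0 = x" "g (dist x y) = y" "G = g ` {0..dist x y}" "G \<subseteq> X"
    and iso: "\<And>s t. s \<in> {0..dist x y} \<Longrightarrow> t \<in> {0..dist x y} \<Longrightarrow> dist (g s) (g t) = \<bar>s - t\<bar>"
    using geodesic_segmentE[OF assms] by metis
  have im: "(\<lambda>s. g (dist x y - s)) ` {0..dist x y} = G"
    unfolding g(3) by (simp flip: image_image[of g "(-) (dist x y)"])
  show ?thesis
    unfolding geodesic_segment_def dist_commute[of y x]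
    by (rule exI[of _ "\<lambda>s. g (dist x y - s)"]) (use im g(1,2,4) iso in auto)
qed

lemma geodesic_segment_singleton: "x \<in> X \<Longrightarrow> geodesic_segment X x x {x}"
  unfolding geodesic_segment_def by (intro exI[of _ "\<lambda>_. x"]) auto

lemma geodesic_segment_dist_add:
  assumes "geodesic_segment X x y G" "p \<in> G"
  shows "dist x p + dist p y = dist x y"
proof -
  obtain g where g: "g 0 = x" "g (dist x y) = y" "G = g ` {0..dist x y}"
    and iso: "\<And>s t. s \<in> {0..dist x y} \<Longrightarrow> t \<in> {0..dist x y} \<Longrightarrow> dist (g s) (g t) = \<bar>s - t\<bar>"
    using geodesic_segmentE[OF assms(1)] by metis
  obtain s where s: "s \<in> {0..dist x y}" "p = g s"
    using assms(2) g(3) by blast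
  show ?thesis
    using iso[of 0 s] iso[of s "dist x y"] s unfolding g(1,2) by simp
qed

text \<open>An inner piece of a geodesic around one of its points, with prescribed distances from that
  point to both ends of the piece.\<close>

lemma geodesic_segment_around:
  assumes "geodesic_segment X x y G" "p \<in> G"
    and ab: "0 \<le> a" "a \<le> dist x p" "0 \<le> b" "b \<le> dist p y"
  obtains u v G' where "geodesic_segment X u v G'" "p \<in> G'" "G' \<subseteq> G"
    "dist p u = a" "dist x u = dist x p - a" "dist p v = b" "dist v y = dist p y - b"
proof -
  obtain g where g: "g 0 = x" "g (dist x y) = y" "G = g ` {0..dist x y}" "G \<subseteq> X"
    and iso: "\<And>s t. s \<in> {0..dist x y} \<Longrightarrow> t \<in> {0..dist x y} \<Longrightarrow> dist (g s) (g t) = \<bar>s - t\<bar>"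
    using geodesic_segmentE[OF assms(1)] by metis
  obtain s where s: "s \<in> {0..dist x y}" "p = g s"
    using assms(2) g(3) by blast
  have xp: "dist x p = s"
    using iso[of 0 s] s g(1) by simp
  have py: "dist p y = dist x y - s"
    using geodesic_segment_dist_add[OF assms(1,2)] xp by simp
  have seg: "geodesic_segment X (g (s - a)) (g (s + b)) (g ` {s - a..s + b})"
    by (rule geodesic_segment_image[OF iso]) (use g ab xp py in auto)
  show ?thesis
  proof (rule that[OF seg])
    show "p \<in> g ` {s - a..s + b}" "g ` {s - a..s + b} \<subseteq> G"
      using s g(3) ab xp py by auto
    show "dist p (g (s - a)) = a" "dist p (g (s + b)) = b"
      using iso[of s "s - a"] iso[of s "s + b"] s ab xp py by auto
    show "dist x (g (s - a)) = dist x p - a" "dist (g (s + b)) y = dist p y - b"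
      using iso[of 0 "s - a"] iso[of "s + b" "dist x y"] s ab xp py g(1,2) by auto
  qed
qed

lemma geodesic_segment_point:
  assumes "geodesic_segment X x y G" "0 \<le> s" "s \<le> dist x y"
  obtains w where "w \<in> G" "dist x w = s"
proof -
  have x: "x \<in> G"
    using geodesic_segment_endpoints(1)[OF assms(1)] .
  show ?thesis
  proof (rule geodesic_segment_around[OF assms(1) x, of 0 s])
    fix u w G' assume "geodesic_segment X u w G'" "G' \<subseteq> G" "dist x w = s"
    then show ?thesis
      using that geodesic_segment_endpoints(2) by blast
  qed (use assms in auto)
qed

lemma geodesic_subsegment:
  assumes "geodesic_segment X x y G" "u \<in> G" "v \<in> G"
  obtains G' where "geodesic_segment X u v G'" "G' \<subseteq> G"
proof -
  obtain g where g: "G = g ` {0..dist x y}" "G \<subseteq> X"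
    and iso: "\<And>s t. s \<in> {0..dist x y} \<Longrightarrow> t \<in> {0..dist x y} \<Longrightarrow> dist (g s) (g t) = \<bar>s - t\<bar>"
    using geodesic_segmentE[OF assms(1)] by metis
  obtain a b where a: "a \<in> {0..dist x y}" "u = g a" and b: "b \<in> {0..dist x y}" "v = g b"
    using assms(2,3) g(1) by blast
  show ?thesis
  proof (cases "a \<le> b")
    case True
    have "geodesic_segment X u v (g ` {a..b})"
      unfolding a(2) b(2)
      by (rule geodesic_segment_image[OF iso]) (use g a(1) b(1) True in auto)
    moreover have "g ` {a..b} \<subseteq> G"
      using g(1) a(1) b(1) by auto
    ultimately show ?thesis
      using that by blast
  next
    case False
    have "geodesic_segment X v u (g ` {b..a})"
      unfolding a(2) b(2)
      by (rule geodesic_segment_image[OF iso]) (use g a(1) b(1) False in auto)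
    moreover have "g ` {b..a} \<subseteq> G"
      using g(1) a(1) b(1) by auto
    ultimately show ?thesis
      using that geodesic_segment_commute by blast
  qed
qed

section \<open>Thin triangles and polygons\<close>

text \<open>Triangles in \<open>X\<close> of perimeter at most \<open>t\<close> are \<open>h\<close>-thin. Only the first side is mentioned:
  the other two are covered because the vertices may be permuted cyclically.\<close>

definition thin_up_to :: "'a::metric_space set \<Rightarrow> real \<Rightarrow> real \<Rightarrow> bool" where
  "thin_up_to X t h \<longleftrightarrow>
     (\<forall>x y z A B C. geodesic_triangle X x y z A B C \<longrightarrow> triangle_perimeter x y z \<le> t \<longrightarrow>
        (\<forall>p\<in>A. infdist p (B \<union> C) \<le> h))"

lemma thin_up_toD:
  assumes "thin_up_to X t h" "geodesic_triangle X x y z A B C" "triangle_perimeter x y z \<le> t"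
    "p \<in> A"
  shows "infdist p (B \<union> C) \<le> h"
  using assms unfolding thin_up_to_def by blast

lemma thin_up_to_mono: "thin_up_to X t h \<Longrightarrow> h \<le> h' \<Longrightarrow> thin_up_to X t h'"
  unfolding thin_up_to_def by (meson order_trans)

lemma geodesic_triangle_rotate:
  "geodesic_triangle X x y z A B C \<Longrightarrow> geodesic_triangle X y z x B C A"
  by (simp add: geodesic_triangle_def)

lemma triangle_perimeter_rotate: "triangle_perimeter y z x = triangle_perimeter x y z"
  by (simp add: triangle_perimeter_def)

lemma infdist_less_obtain:
  assumes "infdist p S < h" "S \<noteq> {}"
  obtains w where "w \<in> S" "dist p w < h"
  using assms unfolding infdist_notempty[OF assms(2)] by (auto simp: cInf_less_iff)

text \<open>Fan triangulation, one triangle at a time: appending the segment \<open>S\<close> from \<open>c\<close> to \<open>d\<close> to a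
  broken geodesic \<open>W\<close> from \<open>a\<close> to \<open>c\<close> costs one triangle, that is, an additional distance \<open>h\<close>.\<close>

lemma near_broken_geodesic_append:
  assumes geo: "geodesic_metric_space X" and thin: "thin_up_to X s h'" and "h' < h"
    and near: "\<And>G p. geodesic_segment X a c G \<Longrightarrow> p \<in> G \<Longrightarrow> \<exists>w\<in>W. dist p w \<le> k"
    and "0 \<le> k"
    and S: "geodesic_segment X c d S" and G: "geodesic_segment X a d G" and "p \<in> G"
    and per: "triangle_perimeter a d c \<le> s" and "a \<in> X" "c \<in> X"
  shows "\<exists>w\<in>W \<union> S. dist p w \<le> k + h"
proof -
  obtain E where E: "geodesic_segment X a c E"
    using geo \<open>a \<in> X\<close> \<open>c \<in> X\<close> unfolding geodesic_metric_space_def by blast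
  have "geodesic_triangle X a d c G S E"
    using G S E geodesic_segment_commute unfolding geodesic_triangle_def by blast
  then have "infdist p (S \<union> E) < h"
    using thin_up_toD[OF thin _ per \<open>p \<in> G\<close>] \<open>h' < h\<close> by fastforce
  moreover have "S \<union> E \<noteq> {}"
    using geodesic_segment_endpoints[OF E] by blast
  ultimately obtain w where w: "w \<in> S \<union> E" "dist p w < h"
    using infdist_less_obtain by metis
  show ?thesis
  proof (cases "w \<in> S")
    case True
    then show ?thesis
      using w(2) \<open>0 \<le> k\<close> by (intro bexI[of _ w]) auto
  next
    case False
    then obtain v where "v \<in> W" "dist w v \<le> k"
      using near[OF E] w(1) by blast
    then show ?thesis
      using w(2) dist_triangle[of p v w] by (intro bexI[of _ v]) auto
  qed
qed

text \<open>The fan consists of the triangles with apex \<open>a\<close>; their vertices are within \<open>R\<close> of \<open>p\<close>, so their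
  perimeters are at most \<open>6 R\<close>. The induction starts with the broken geodesic \<open>{a}\<close>, which makes one
  degenerate triangle and explains the factor \<open>5\<close>.\<close>

lemma near_hexagon:
  assumes geo: "geodesic_metric_space X" and thin: "thin_up_to X (6 * R) h'" and "0 \<le> h'" "h' < h"
    and seg: "geodesic_segment X a b G" "geodesic_segment X a c1 S1" "geodesic_segment X c1 c2 S2"
      "geodesic_segment X c2 c3 S3" "geodesic_segment X c3 c4 S4" "geodesic_segment X c4 b S5"
    and "p \<in> G"
    and R: "dist p a \<le> R" "dist p b \<le> R" "dist p c1 \<le> R" "dist p c2 \<le> R" "dist p c3 \<le> R"
      "dist p c4 \<le> R"
  shows "\<exists>w\<in>S1 \<union> S2 \<union> S3 \<union> S4 \<union> S5. dist p w \<le> 5 * h"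
proof -
  have X: "a \<in> X" "c1 \<in> X" "c2 \<in> X" "c3 \<in> X" "c4 \<in> X"
    using seg geodesic_segment_endpoints geodesic_segment_subset by blast+
  have per: "triangle_perimeter u v w \<le> 6 * R"
    if "dist p u \<le> R" "dist p v \<le> R" "dist p w \<le> R" for u v w
    using that dist_triangle3[of u v p] dist_triangle3[of v w p] dist_triangle3[of w u p]
    unfolding triangle_perimeter_def by linarith
  have "0 \<le> h"
    using assms(3,4) by simp
  note app = near_broken_geodesic_append[OF geo thin \<open>h' < h\<close>]
  have n0: "\<exists>w\<in>{a}. dist q w \<le> 0" if "geodesic_segment X a a H" "q \<in> H" for H q
    using geodesic_segment_dist_le[OF that] by simp
  have n1: "\<exists>w\<in>{a} \<union> S1. dist q w \<le> 0 + h" if "geodesic_segment X a c1 H" "q \<in> H" for H q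
    by (rule app[OF n0 _ seg(2) that]) (use X R per in auto)
  have n2: "\<exists>w\<in>{a} \<union> S1 \<union> S2. dist q w \<le> 0 + h + h"
    if "geodesic_segment X a c2 H" "q \<in> H" for H q
    by (rule app[OF n1 _ seg(3) that]) (use X R per \<open>0 \<le> h\<close> in auto)
  have n3: "\<exists>w\<in>{a} \<union> S1 \<union> S2 \<union> S3. dist q w \<le> 0 + h + h + h"
    if "geodesic_segment X a c3 H" "q \<in> H" for H q
    by (rule app[OF n2 _ seg(4) that]) (use X R per \<open>0 \<le> h\<close> in auto)
  have n4: "\<exists>w\<in>{a} \<union> S1 \<union> S2 \<union> S3 \<union> S4. dist q w \<le> 0 + h + h + h + h"
    if "geodesic_segment X a c4 H" "q \<in> H" for H q
    by (rule app[OF n3 _ seg(5) that]) (use X R per \<open>0 \<le> h\<close> in auto)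
  have n5: "\<exists>w\<in>{a} \<union> S1 \<union> S2 \<union> S3 \<union> S4 \<union> S5. dist p w \<le> 0 + h + h + h + h + h"
    by (rule app[OF n4 _ seg(6,1) \<open>p \<in> G\<close>]) (use X R per \<open>0 \<le> h\<close> in auto)
  moreover have "a \<in> S1"
    using geodesic_segment_endpoints(1)[OF seg(2)] .
  ultimately show ?thesis
    by auto
qed

section \<open>Halving the thinness constant\<close>

text \<open>From a point \<open>m\<close> of the side \<open>A\<close> one reaches the other two sides \<open>T\<close> along a short segment
  that avoids a neighbourhood of \<open>p\<close>: either \<open>m\<close> is far from \<open>p\<close>, or it already lies on \<open>T\<close>.\<close>

lemma foot_far_from_point:
  assumes geo: "geodesic_metric_space X" and "0 < F"
    and far: "infdist p T > F / 2" and "T \<subseteq> X" "T \<noteq> {}" and "m \<in> X"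
    and near: "infdist m T \<le> F"
    and m: "m \<in> T \<or> dist p m = 4 * F"
  obtains q S where "q \<in> T" "dist m q \<le> 2 * F" "geodesic_segment X m q S"
    "\<And>w. w \<in> S \<Longrightarrow> dist p w > F / 2"
proof (cases "m \<in> T")
  case True
  show ?thesis
  proof (rule that)
    show "geodesic_segment X m m {m}"
      by (rule geodesic_segment_singleton[OF \<open>m \<in> X\<close>])
    show "dist p w > F / 2" if "w \<in> {m}" for w
      using that far infdist_le[OF True, of p] by simp
  qed (use True \<open>0 < F\<close> in auto)
next
  case False
  have "infdist m T < 2 * F"
    using near \<open>0 < F\<close> by simp
  then obtain q where q: "q \<in> T" "dist m q < 2 * F"
    using infdist_less_obtain[OF _ \<open>T \<noteq> {}\<close>] by metis
  obtain S where S: "geodesic_segment X m q S"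
    using geo \<open>m \<in> X\<close> q(1) \<open>T \<subseteq> X\<close> unfolding geodesic_metric_space_def by blast
  have "dist p w > F / 2" if "w \<in> S" for w
    using geodesic_segment_dist_le[OF S that] q(2) m False \<open>0 < F\<close> dist_triangle[of p m w]
    by auto
  then show ?thesis
    using that q S by fastforce
qed

text \<open>A detour from \<open>u\<close> to \<open>v\<close> for two points on different sides meeting at \<open>z\<close>: follow the first
  side towards \<open>z\<close> for a length of \<open>20 F\<close> (or up to \<open>z\<close>), cross over to the second side, and follow
  it to \<open>v\<close>. The crossing is short, because the triangle \<open>u\<close>, \<open>v\<close>, \<open>z\<close> is thin and its side from
  \<open>u\<close> to \<open>v\<close> is too close to \<open>u\<close> to matter.\<close>

lemma detour_between_sides:
  assumes geo: "geodesic_metric_space X" and "0 < F" and thin: "thin_up_to X t F"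
    and segC: "geodesic_segment X z x C" and segB: "geodesic_segment X z y B"
    and per: "triangle_perimeter x y z \<le> t"
    and u: "u \<in> C" "dist p u \<le> 6 * F" and v: "v \<in> B" "dist p v \<le> 6 * F"
    and far: "infdist p (B \<union> C) > F / 2"
  obtains r r' S2 S3 S4 where "geodesic_segment X u r S2" "geodesic_segment X r r' S3"
    "geodesic_segment X r' v S4" "dist p r \<le> 28 * F" "dist p r' \<le> 28 * F"
    "\<And>w. w \<in> S2 \<union> S3 \<union> S4 \<Longrightarrow> dist p w > F / 2"
proof -
  have z: "z \<in> B" "z \<in> C" and X: "B \<subseteq> X" "C \<subseteq> X"
    using segB segC geodesic_segment_endpoints geodesic_segment_subset by blast+
  have farBC: "dist p w > F / 2" if "w \<in> B \<union> C" for w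
    using far infdist_le[OF that, of p] by simp
  obtain C' where C': "geodesic_segment X u z C'" "C' \<subseteq> C"
    using geodesic_subsegment[OF segC u(1) z(2)] .
  obtain B' where B': "geodesic_segment X z v B'" "B' \<subseteq> B"
    using geodesic_subsegment[OF segB z(1) v(1)] .
  show ?thesis
  proof (cases "dist u z \<le> 20 * F")
    case True
    show ?thesis
    proof (rule that)
      show "geodesic_segment X u z C'" "geodesic_segment X z v B'" "geodesic_segment X z z {z}"
        using C' B' geodesic_segment_singleton[of z X] z X by auto
      show "dist p z \<le> 28 * F" "dist p z \<le> 28 * F"
        using True u(2) dist_triangle[of p z u] \<open>0 < F\<close> by auto
      show "dist p w > F / 2" if "w \<in> C' \<union> {z} \<union> B'" for w
        using that farBC z C'(2) B'(2) by blast
    qed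
  next
    case False
    obtain r where r: "r \<in> C'" "dist u r = 20 * F"
      using geodesic_segment_point[OF C'(1), of "20 * F"] False \<open>0 < F\<close> by auto
    obtain E where E: "geodesic_segment X v u E"
      using geo u(1) v(1) X unfolding geodesic_metric_space_def by blast
    have tri: "geodesic_triangle X u z v C' B' E"
      using C' B' E unfolding geodesic_triangle_def by blast
    \<comment> \<open>Cutting off the vertices \<open>x\<close> and \<open>y\<close> does not increase the perimeter.\<close>
    have "dist u v \<le> dist u x + dist x y + dist y v"
      using dist_triangle[of u v x] dist_triangle[of x v y] by linarith
    then have "triangle_perimeter u z v \<le> t"
      using geodesic_segment_dist_add[OF segC u(1)] geodesic_segment_dist_add[OF segB v(1)] per
      unfolding triangle_perimeter_def by (simp add: dist_commute)
    then have "infdist r (B' \<union> E) < 2 * F"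
      using thin_up_toD[OF thin tri _ r(1)] \<open>0 < F\<close> by simp
    moreover have "B' \<union> E \<noteq> {}"
      using geodesic_segment_endpoints[OF E] by blast
    ultimately obtain r' where r': "r' \<in> B' \<union> E" "dist r r' < 2 * F"
      using infdist_less_obtain by metis
    \<comment> \<open>All of \<open>E\<close> is within \<open>12 F\<close> of \<open>u\<close>, but \<open>r'\<close> is at distance more than \<open>18 F\<close> from \<open>u\<close>.\<close>
    have "r' \<notin> E"
    proof
      assume "r' \<in> E"
      then have "dist r' u \<le> dist u v"
        using geodesic_segment_dist_le[OF geodesic_segment_commute[OF E]] by blast
      then show False
        using r(2) r'(2) u(2) v(2) dist_triangle3[of u v p] dist_triangle[of u r r'] \<open>0 < F\<close>
        by (simp add: dist_commute)
    qed
    then have "r' \<in> B'"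
      using r'(1) by blast
    obtain S3 where S3: "geodesic_segment X r r' S3"
      using geo r(1) \<open>r' \<in> B'\<close> C'(2) B'(2) X unfolding geodesic_metric_space_def by blast
    obtain S2 where S2: "geodesic_segment X u r S2" "S2 \<subseteq> C'"
      using geodesic_subsegment[OF C'(1) geodesic_segment_endpoints(1)[OF C'(1)] r(1)] .
    obtain S4 where S4: "geodesic_segment X r' v S4" "S4 \<subseteq> B'"
      using geodesic_subsegment[OF B'(1) \<open>r' \<in> B'\<close> geodesic_segment_endpoints(2)[OF B'(1)]] .
    show ?thesis
    proof (rule that[OF S2(1) S3 S4(1)])
      show pr: "dist p r \<le> 28 * F"
        using r(2) u(2) dist_triangle[of p r u] \<open>0 < F\<close> by linarith
      show "dist p r' \<le> 28 * F"
        using r(2) u(2) r'(2) dist_triangle[of p r u] dist_triangle[of p r' r] \<open>0 < F\<close> by linarith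
      have "dist p r \<ge> 14 * F"
        using r(2) u(2) dist_triangle3[of u r p] by linarith
      then have "dist p w > F / 2" if "w \<in> S3" for w
        using geodesic_segment_dist_le[OF S3 that] r'(2) dist_triangle[of p r w] \<open>0 < F\<close> by linarith
      then show "dist p w > F / 2" if "w \<in> S2 \<union> S3 \<union> S4" for w
        using that farBC S2(2) S4(2) C'(2) B'(2) by blast
    qed
  qed
qed

lemma detour_along_two_sides:
  assumes geo: "geodesic_metric_space X" and "0 < F" and thin: "thin_up_to X t F"
    and segC: "geodesic_segment X z x C" and segB: "geodesic_segment X z y B"
    and per: "triangle_perimeter x y z \<le> t"
    and u: "u \<in> B \<union> C" "dist p u \<le> 6 * F" and v: "v \<in> B \<union> C" "dist p v \<le> 6 * F"
    and far: "infdist p (B \<union> C) > F / 2"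
  obtains r r' S2 S3 S4 where "geodesic_segment X u r S2" "geodesic_segment X r r' S3"
    "geodesic_segment X r' v S4" "dist p r \<le> 28 * F" "dist p r' \<le> 28 * F"
    "\<And>w. w \<in> S2 \<union> S3 \<union> S4 \<Longrightarrow> dist p w > F / 2"
proof -
  note detour = that
  have same_side: thesis
    if side: "geodesic_segment X a b D" "u \<in> D" "v \<in> D" and "D \<subseteq> B \<union> C" for a b D
  proof -
    obtain S where S: "geodesic_segment X u v S" "S \<subseteq> D"
      using geodesic_subsegment[OF side] .
    have v1: "geodesic_segment X v v {v}"
      using geodesic_segment_singleton geodesic_segment_subset[OF side(1)] side(3) by blast
    have v28: "dist p v \<le> 28 * F"
      using v(2) \<open>0 < F\<close> by linarith
    show ?thesis
    proof (rule detour[OF S(1) v1 v1 v28 v28])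
      fix w assume "w \<in> S \<union> {v} \<union> {v}"
      then have "w \<in> B \<union> C"
        using S(2) \<open>D \<subseteq> B \<union> C\<close> v(1) by blast
      then show "dist p w > F / 2"
        using far infdist_le[of w "B \<union> C" p] by linarith
    qed
  qed
  consider "u \<in> C" "v \<in> B" | "u \<in> B" "v \<in> C" | "u \<in> B" "v \<in> B" | "u \<in> C" "v \<in> C"
    using u(1) v(1) by blast
  then show ?thesis
  proof cases
    case 1
    then show ?thesis
      using detour_between_sides[OF geo \<open>0 < F\<close> thin segC segB per _ u(2) _ v(2) far] that by metis
  next
    case 2
    obtain r r' S2 S3 S4 where *: "geodesic_segment X v r S2" "geodesic_segment X r r' S3"
      "geodesic_segment X r' u S4" "dist p r \<le> 28 * F" "dist p r' \<le> 28 * F"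
      "\<And>w. w \<in> S2 \<union> S3 \<union> S4 \<Longrightarrow> dist p w > F / 2"
      using detour_between_sides[OF geo \<open>0 < F\<close> thin segC segB per 2(2) v(2) 2(1) u(2) far] by metis
    show ?thesis
      using that[OF *(3,2,1)[THEN geodesic_segment_commute] *(5,4)] *(6) by blast
  next
    case 3
    show ?thesis
      using same_side[OF segB 3] by simp
  next
    case 4
    show ?thesis
      using same_side[OF segC 4] by simp
  qed
qed

lemma thin_up_to_halve:
  assumes geo: "geodesic_metric_space X" and "0 < F" and thin: "thin_up_to X t F"
    and small: "thin_up_to X (6 * (28 * F)) (F / 40)"
  shows "thin_up_to X t (F / 2)"
  unfolding thin_up_to_def
proof (intro allI impI ballI, rule ccontr)
  fix x y z A B C p
  assume tri: "geodesic_triangle X x y z A B C" and per: "triangle_perimeter x y z \<le> t"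
    and "p \<in> A" and "\<not> infdist p (B \<union> C) \<le> F / 2"
  then have far: "infdist p (B \<union> C) > F / 2"
    by simp
  have seg: "geodesic_segment X x y A" "geodesic_segment X y z B" "geodesic_segment X z x C"
    using tri by (auto simp: geodesic_triangle_def)
  have BC: "B \<union> C \<subseteq> X" "B \<union> C \<noteq> {}" "x \<in> B \<union> C" "y \<in> B \<union> C" and "A \<subseteq> X"
    using seg geodesic_segment_endpoints geodesic_segment_subset by blast+
  obtain m n G where G: "geodesic_segment X m n G" "p \<in> G" "G \<subseteq> A"
    and m: "dist p m = min (4 * F) (dist x p)" "dist x m = dist x p - min (4 * F) (dist x p)"
    and n: "dist p n = min (4 * F) (dist p y)" "dist n y = dist p y - min (4 * F) (dist p y)"
    using geodesic_segment_around[OF seg(1) \<open>p \<in> A\<close>,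
        of "min (4 * F) (dist x p)" "min (4 * F) (dist p y)"] \<open>0 < F\<close>
    by auto
  have mn: "m \<in> A" "n \<in> A"
    using G geodesic_segment_endpoints by blast+
  have m4: "m \<in> B \<union> C \<or> dist p m = 4 * F"
    using m BC(3) by (cases "4 * F \<le> dist x p") auto
  have n4: "n \<in> B \<union> C \<or> dist p n = 4 * F"
    using n BC(4) by (cases "4 * F \<le> dist p y") auto
  note foot = foot_far_from_point[OF geo \<open>0 < F\<close> far BC(1,2)]
  obtain q S1 where q: "q \<in> B \<union> C" "dist m q \<le> 2 * F" and S1: "geodesic_segment X m q S1"
    and far1: "\<And>w. w \<in> S1 \<Longrightarrow> dist p w > F / 2"
    using foot[OF _ thin_up_toD[OF thin tri per mn(1)] m4] mn(1) \<open>A \<subseteq> X\<close> by blast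
  obtain q' S5 where q': "q' \<in> B \<union> C" "dist n q' \<le> 2 * F" and S5: "geodesic_segment X n q' S5"
    and far5: "\<And>w. w \<in> S5 \<Longrightarrow> dist p w > F / 2"
    using foot[OF _ thin_up_toD[OF thin tri per mn(2)] n4] mn(2) \<open>A \<subseteq> X\<close> by blast
  have pq: "dist p q \<le> 6 * F" "dist p q' \<le> 6 * F"
    using m(1) n(1) q(2) q'(2) dist_triangle[of p q m] dist_triangle[of p q' n] by linarith+
  obtain r r' S2 S3 S4 where S: "geodesic_segment X q r S2" "geodesic_segment X r r' S3"
      "geodesic_segment X r' q' S4" and r: "dist p r \<le> 28 * F" "dist p r' \<le> 28 * F"
    and farS: "\<And>w. w \<in> S2 \<union> S3 \<union> S4 \<Longrightarrow> dist p w > F / 2"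
    using detour_along_two_sides[OF geo \<open>0 < F\<close> thin seg(3) geodesic_segment_commute[OF seg(2)]
        per q(1) pq(1) q'(1) pq(2) far] by metis
  \<comment> \<open>Thinness is needed with a constant strictly below \<open>F / 20\<close>, as infima need not be attained.\<close>
  have "\<exists>w\<in>S1 \<union> S2 \<union> S3 \<union> S4 \<union> S5. dist p w \<le> 5 * (F / 20)"
    by (rule near_hexagon[OF geo small _ _ G(1) S1 S geodesic_segment_commute[OF S5] G(2)])
      (use m n r pq \<open>0 < F\<close> in auto)
  then obtain w where w: "w \<in> S1 \<union> S2 \<union> S3 \<union> S4 \<union> S5" "dist p w \<le> F / 4"
    by auto
  then have "dist p w > F / 2"
    using far1 far5 farS by blast
  then show False
    using w(2) \<open>0 < F\<close> by simp
qed

section \<open>The hyperbolicity function\<close>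

lemma thin_up_to_iff_triangle_delta:
  "thin_up_to X t h \<longleftrightarrow>
     (\<forall>x y z A B C. geodesic_triangle X x y z A B C \<longrightarrow> triangle_perimeter x y z \<le> t \<longrightarrow>
        triangle_delta A B C \<le> h)"
proof (intro iffI allI impI)
  fix x y z A B C
  assume thin: "thin_up_to X t h" and tri: "geodesic_triangle X x y z A B C"
    and per: "triangle_perimeter x y z \<le> t"
  note tri2 = geodesic_triangle_rotate[OF tri]
  note tri3 = geodesic_triangle_rotate[OF tri2]
  have "A \<noteq> {}"
    using tri geodesic_segment_endpoints unfolding geodesic_triangle_def by blast
  then show "triangle_delta A B C \<le> h"
    unfolding triangle_delta_def
    using thin_up_toD[OF thin tri per] thin_up_toD[OF thin tri2] thin_up_toD[OF thin tri3] per
    by (intro cSup_least) (auto simp: triangle_perimeter_rotate)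
next
  assume *: "\<forall>x y z A B C. geodesic_triangle X x y z A B C \<longrightarrow> triangle_perimeter x y z \<le> t \<longrightarrow>
        triangle_delta A B C \<le> h"
  show "thin_up_to X t h"
    unfolding thin_up_to_def
  proof (intro allI impI ballI)
    fix x y z A B C p
    assume tri: "geodesic_triangle X x y z A B C" and per: "triangle_perimeter x y z \<le> t"
      and "p \<in> A"
    then have "infdist p (B \<union> C) \<le> triangle_delta A B C"
      unfolding triangle_delta_def by (intro cSup_upper bdd_above_triangle_delta[OF tri]) blast
    then show "infdist p (B \<union> C) \<le> h"
      using * tri per by fastforce
  qed
qed

lemma thin_up_to_hyperbolicity_function: "thin_up_to X t (hyperbolicity_function X t)"
  unfolding thin_up_to_iff_triangle_delta hyperbolicity_function_def
  by (intro allI impI cSup_upper bdd_above_hyperbolicity_function) blast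

lemma geodesic_triangle_trivial: "x \<in> X \<Longrightarrow> geodesic_triangle X x x x {x} {x} {x}"
  by (simp add: geodesic_triangle_def geodesic_segment_singleton)

lemma hyperbolicity_function_le:
  assumes "thin_up_to X t h" "X \<noteq> {}" "0 \<le> t"
  shows "hyperbolicity_function X t \<le> h"
proof -
  obtain x where "x \<in> X"
    using assms(2) by blast
  moreover have "triangle_perimeter x x x \<le> t"
    using assms(3) by (simp add: triangle_perimeter_def)
  ultimately show ?thesis
    using assms(1) geodesic_triangle_trivial[of x X]
    unfolding thin_up_to_iff_triangle_delta hyperbolicity_function_def
    by (intro cSup_least) blast+
qed

lemma hyperbolicity_function_nonneg:
  assumes "X \<noteq> {}" "0 \<le> t"
  shows "0 \<le> hyperbolicity_function X t"
proof -
  obtain x where "x \<in> X"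
    using assms(1) by blast
  then have "infdist x ({x} \<union> {x}) \<le> hyperbolicity_function X t"
    using thin_up_toD[OF thin_up_to_hyperbolicity_function geodesic_triangle_trivial] assms(2)
    by (metis (no_types, lifting) dist_self add_0 singletonI triangle_perimeter_def)
  then show ?thesis
    using infdist_nonneg order_trans by blast
qed

lemma thin_up_to_if_hyperbolic_space:
  assumes "hyperbolic_space X"
  obtains h where "\<And>t. thin_up_to X t h"
proof -
  obtain \<delta> where \<delta>: "\<And>x y z A B C. geodesic_triangle X x y z A B C \<Longrightarrow>
      A \<subseteq> metric_neighbourhood \<delta> (B \<union> C)"
    using assms unfolding hyperbolic_space_def by metis
  have "infdist p (B \<union> C) \<le> \<delta>"
    if tri: "geodesic_triangle X x y z A B C" and p: "p \<in> A" for x y z A B C p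
  proof -
    have "p \<in> (\<Union>q\<in>B \<union> C. ball q \<delta>)"
      using \<delta>[OF tri] p unfolding metric_neighbourhood_def by blast
    then obtain q where "q \<in> B \<union> C" "dist q p < \<delta>"
      by (auto simp del: UN_Un)
    then show ?thesis
      using infdist_le[of q "B \<union> C" p] by (simp add: dist_commute)
  qed
  then show ?thesis
    using that unfolding thin_up_to_def by blast
qed

lemma hyperbolic_space_if_thin_up_to:
  assumes thin: "\<And>t. thin_up_to X t h"
  shows "hyperbolic_space X"
proof -
  have sub: "A \<subseteq> metric_neighbourhood (\<bar>h\<bar> + 1) (B \<union> C)"
    if tri: "geodesic_triangle X x y z A B C" for x y z A B C
  proof
    fix p assume "p \<in> A"
    have "infdist p (B \<union> C) < \<bar>h\<bar> + 1"
      using thin_up_toD[OF thin tri order_refl \<open>p \<in> A\<close>] by linarith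
    moreover have "B \<union> C \<noteq> {}"
      using tri geodesic_segment_endpoints unfolding geodesic_triangle_def by blast
    ultimately obtain q where "q \<in> B \<union> C" "dist p q < \<bar>h\<bar> + 1"
      using infdist_less_obtain by metis
    then show "p \<in> metric_neighbourhood (\<bar>h\<bar> + 1) (B \<union> C)"
      unfolding metric_neighbourhood_def by (auto simp: dist_commute)
  qed
  show ?thesis
    unfolding hyperbolic_space_def
  proof (intro exI[of _ "\<bar>h\<bar> + 1"] conjI allI impI)
    fix x y z A B C
    assume tri: "geodesic_triangle X x y z A B C"
    note tri2 = geodesic_triangle_rotate[OF tri]
    show "A \<subseteq> metric_neighbourhood (\<bar>h\<bar> + 1) (B \<union> C)"
      "B \<subseteq> metric_neighbourhood (\<bar>h\<bar> + 1) (C \<union> A)"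
      "C \<subseteq> metric_neighbourhood (\<bar>h\<bar> + 1) (A \<union> B)"
      using sub[OF tri] sub[OF tri2] sub[OF geodesic_triangle_rotate[OF tri2]] by blast+
  qed simp
qed

theorem theorem2p13:
  fixes X :: "'a::metric_space set"
  assumes "geodesic_metric_space X"
  shows "hyperbolic_space X \<longleftrightarrow>
         ((\<lambda>t. hyperbolicity_function X t / t) \<longlongrightarrow> 0) at_top"
proof
  assume "hyperbolic_space X"
  then obtain h where h: "\<And>t. thin_up_to X t h"
    using thin_up_to_if_hyperbolic_space by metis
  \<comment> \<open>For empty \<open>X\<close> the function is constant, though its value is unspecified.\<close>
  have "\<exists>K. \<forall>t\<ge>0. \<bar>hyperbolicity_function X t\<bar> \<le> K"
  proof (cases "X = {}")
    case True
    then have "\<not> geodesic_triangle X x y z A B C" for x y z A B C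
      using geodesic_segment_endpoints geodesic_segment_subset
      unfolding geodesic_triangle_def by blast
    then show ?thesis
      unfolding hyperbolicity_function_def by auto
  next
    case False
    then show ?thesis
      using hyperbolicity_function_le[OF h] hyperbolicity_function_nonneg by (metis abs_of_nonneg)
  qed
  then obtain K where K: "\<And>t. t \<ge> 0 \<Longrightarrow> \<bar>hyperbolicity_function X t\<bar> \<le> K"
    by blast
  have lim: "((\<lambda>t::real. K / t) \<longlongrightarrow> 0) at_top"
    by (intro tendsto_divide_0[OF tendsto_const] filterlim_at_top_imp_at_infinity filterlim_ident)
  show "((\<lambda>t. hyperbolicity_function X t / t) \<longlongrightarrow> 0) at_top"
  proof (rule Lim_null_comparison[OF _ lim])
    show "\<forall>\<^sub>F t in at_top. norm (hyperbolicity_function X t / t) \<le> K / t"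
      using eventually_gt_at_top[of "0::real"]
      by eventually_elim (use K in \<open>auto simp: divide_right_mono\<close>)
  qed
next
  assume lim: "((\<lambda>t. hyperbolicity_function X t / t) \<longlongrightarrow> 0) at_top"
  \<comment> \<open>\<open>6720 = 40 * 168\<close>, so that \<open>f (168 F) < F / 40\<close> for large \<open>F\<close>.\<close>
  have "\<forall>\<^sub>F t in at_top. hyperbolicity_function X t / t < 1 / 6720"
    by (rule order_tendstoD(2)[OF lim]) simp
  then obtain T where T: "\<And>t. t \<ge> T \<Longrightarrow> hyperbolicity_function X t / t < 1 / 6720"
    unfolding eventually_at_top_linorder by blast
  define M where "M = max T 1"
  have "thin_up_to X t M" for t
  proof (cases "X \<noteq> {} \<and> 0 \<le> t \<and> M < hyperbolicity_function X t")
    case True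
    define F where "F = hyperbolicity_function X t"
    have F: "F > T" "F > 1"
      using True unfolding F_def M_def by auto
    have "hyperbolicity_function X (6 * (28 * F)) < F / 40"
      using T[of "6 * (28 * F)"] F by (simp add: field_simps)
    then have "thin_up_to X (6 * (28 * F)) (F / 40)"
      using thin_up_to_mono[OF thin_up_to_hyperbolicity_function] by (meson less_imp_le)
    moreover have "thin_up_to X t F"
      unfolding F_def by (rule thin_up_to_hyperbolicity_function)
    ultimately have "thin_up_to X t (F / 2)"
      using thin_up_to_halve[OF assms, of F t] F by simp
    then have "F \<le> F / 2"
      using hyperbolicity_function_le True unfolding F_def by blast
    then show ?thesis
      using F by simp
  next
    case False
    then consider "X = {}" | "t < 0" | "hyperbolicity_function X t \<le> M"
      by fastforce
    then show ?thesis
    proof cases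
      case 1
      then show ?thesis
        using geodesic_segment_endpoints geodesic_segment_subset
        unfolding thin_up_to_def geodesic_triangle_def by blast
    next
      case 2
      have "0 \<le> triangle_perimeter x y z" for x y z :: 'a
        by (simp add: triangle_perimeter_def)
      then show ?thesis
        using 2 unfolding thin_up_to_def by (meson le_less_trans not_le)
    next
      case 3
      then show ?thesis
        using thin_up_to_mono[OF thin_up_to_hyperbolicity_function] by blast
    qed
  qed
  then show "hyperbolic_space X"
    by (rule hyperbolic_space_if_thin_up_to)
qed

end
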